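(* Let $S$ be a ring. Then the following hold: (1) For any $m \geq 1$ and any $n \geq 2$, the ring $D_m(S)$ satisfies Property $K_n$ if and only if $S$ satisfies Property $K_n$. (2) For any $m \geq 1$ and any $n \geq 2$, the ring $D_m(S)$ satisfies Property $\overline{K_n}$ if and only if $S$ satisfies Property $\overline{K_n}$.
   Context: Rings are associative with unity, not necessarily commutative. $D_m(S)$ is the ring of $m\times m$ upper triangular matrices $(a_{ij})$ over $S$ with equal diagonal entries $a_{11} = a_{22} = \cdots = a_{mm}$. An element $x$ of a ring is $n$-potent if $x^n = x$. For elements $a,b$ of a ring and an integer $n \geq 2$: $\langle a,b\rangle_n := (a+b)^n - a^n - b^n$, $[a,b]_n^L := (a-b)(a+b)^{n-1} - (a^n - b^n)$, and $[a,b]_n^R := (a+b)^{n-1}(a-b) - (a^n-b^n)$. A ring $R$ satisfies Property $K_n$ if there exist $n$-potent elements $a,b \in R$ such that $[a,b]_n^L$ and $[a,b]_n^R$ are both units in $R$. A ring $R$ satisfies Property $\overline{K_n}$ if there exist $n$-potent elements $a,b \in R$ such that $\langle a,b\rangle_n$ is a unit in $R$. *)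

theory Defs
  imports "HOL-Algebra.Ring" "Jordan_Normal_Form.Matrix"
begin

text \<open>
  Rings are HOL-Algebra rings (associative, with unity, not necessarily commutative; the zero ring
  is allowed). Matrices over such a ring are matrices of the type \<^typ>\<open>'a mat\<close> with entries in
  the carrier. The library's own matrix ring takes its entries from a type class, so
  the operations are given here for an arbitrary ring record.
  Row and column indices run from 0.
\<close>

definition mat_ring :: "('a, 'b) ring_scheme \<Rightarrow> nat \<Rightarrow> 'a mat ring" where
  "mat_ring S m = \<lparr>
     carrier = {A \<in> carrier_mat m m. \<forall>i<m. \<forall>j<m. A $$ (i, j) \<in> carrier S},
     mult = (\<lambda>A B. mat m m (\<lambda>(i, j). \<Oplus>\<^bsub>S\<^esub>k\<in>{..<m}. A $$ (i, k) \<otimes>\<^bsub>S\<^esub> B $$ (k, j))),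
     one = mat m m (\<lambda>(i, j). if i = j then \<one>\<^bsub>S\<^esub> else \<zero>\<^bsub>S\<^esub>),
     zero = mat m m (\<lambda>(i, j). \<zero>\<^bsub>S\<^esub>),
     add = (\<lambda>A B. mat m m (\<lambda>(i, j). A $$ (i, j) \<oplus>\<^bsub>S\<^esub> B $$ (i, j))) \<rparr>"

definition D_ring :: "nat \<Rightarrow> ('a, 'b) ring_scheme \<Rightarrow> 'a mat ring" where
  "D_ring m S = (mat_ring S m) \<lparr> carrier :=
     {A \<in> carrier (mat_ring S m).
        (\<forall>i<m. \<forall>j<i. A $$ (i, j) = \<zero>\<^bsub>S\<^esub>) \<and>
        (\<forall>i<m. \<forall>j<m. A $$ (i, i) = A $$ (j, j))} \<rparr>"

definition potent :: "('a, 'b) ring_scheme \<Rightarrow> nat \<Rightarrow> 'a \<Rightarrow> bool" where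
  "potent R n x \<longleftrightarrow> x \<in> carrier R \<and> x [^]\<^bsub>R\<^esub> n = x"

definition angle_br :: "('a, 'b) ring_scheme \<Rightarrow> nat \<Rightarrow> 'a \<Rightarrow> 'a \<Rightarrow> 'a" where
  "angle_br R n a b =
     ((a \<oplus>\<^bsub>R\<^esub> b) [^]\<^bsub>R\<^esub> n \<ominus>\<^bsub>R\<^esub> a [^]\<^bsub>R\<^esub> n) \<ominus>\<^bsub>R\<^esub> b [^]\<^bsub>R\<^esub> n"

definition bracket_L :: "('a, 'b) ring_scheme \<Rightarrow> nat \<Rightarrow> 'a \<Rightarrow> 'a \<Rightarrow> 'a" where
  "bracket_L R n a b =
     ((a \<ominus>\<^bsub>R\<^esub> b) \<otimes>\<^bsub>R\<^esub> (a \<oplus>\<^bsub>R\<^esub> b) [^]\<^bsub>R\<^esub> (n - 1))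
       \<ominus>\<^bsub>R\<^esub> (a [^]\<^bsub>R\<^esub> n \<ominus>\<^bsub>R\<^esub> b [^]\<^bsub>R\<^esub> n)"

definition bracket_R :: "('a, 'b) ring_scheme \<Rightarrow> nat \<Rightarrow> 'a \<Rightarrow> 'a \<Rightarrow> 'a" where
  "bracket_R R n a b =
     ((a \<oplus>\<^bsub>R\<^esub> b) [^]\<^bsub>R\<^esub> (n - 1) \<otimes>\<^bsub>R\<^esub> (a \<ominus>\<^bsub>R\<^esub> b))
       \<ominus>\<^bsub>R\<^esub> (a [^]\<^bsub>R\<^esub> n \<ominus>\<^bsub>R\<^esub> b [^]\<^bsub>R\<^esub> n)"

definition property_K :: "('a, 'b) ring_scheme \<Rightarrow> nat \<Rightarrow> bool" where
  "property_K R n \<longleftrightarrow>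
     (\<exists>a b. potent R n a \<and> potent R n b \<and>
        bracket_L R n a b \<in> Units R \<and> bracket_R R n a b \<in> Units R)"

definition property_K_bar :: "('a, 'b) ring_scheme \<Rightarrow> nat \<Rightarrow> bool" where
  "property_K_bar R n \<longleftrightarrow>
     (\<exists>a b. potent R n a \<and> potent R n b \<and> angle_br R n a b \<in> Units R)"

end

theory Submission
  imports Defs "HOL-Algebra.Subrings"
begin

text \<open>
  A unital ring homomorphism \<open>h : R \<rightarrow> T\<close> carries \<open>n\<close>-potent elements to \<open>n\<close>-potent elements, commutes
  with the three brackets, and carries units to units. Hence both properties pass from \<open>R\<close> to \<open>T\<close>
  along any such \<open>h\<close>, by applying \<open>h\<close> to a witnessing pair (lemmas \<open>property_K_hom\<close> and
  \<open>property_K_bar_hom\<close>).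

  Between \<open>S\<close> and \<open>D_m(S)\<close> there are such homomorphisms in both directions: an element of \<open>S\<close> goes to
  its scalar matrix (\<open>scalar_matrix_hom\<close>), and, for \<open>m \<ge> 1\<close>, a matrix in \<open>D_m(S)\<close> goes to its common
  diagonal entry (\<open>diagonal_entry_hom\<close>). The latter is multiplicative because the diagonal entries
  of a product of upper triangular matrices are the products of the diagonal entries. Each of the
  two equivalences uses one homomorphism per implication; in particular, potents and units of
  \<open>S\<close> are never lifted through an arbitrary matrix, only through scalar ones.

  Both homomorphisms presuppose that \<open>D_m(S)\<close> is a ring. It is obtained as a subring of the full
  matrix ring, where the order of the factors is respected throughout, so that \<open>S\<close> may be
  noncommutative.
\<close>

section \<open>Transfer along ring homomorphisms\<close>

context ring_hom_ring
begin

lemma hom_minus: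
  assumes "x \<in> carrier R" "y \<in> carrier R"
  shows "h (x \<ominus> y) = h x \<ominus>\<^bsub>S\<^esub> h y"
  using assms by (simp add: R.minus_eq S.minus_eq)

lemma hom_potent: "potent R n x \<Longrightarrow> potent S n (h x)"
  unfolding potent_def using hom_nat_pow[of x n] by auto

lemma hom_Units:
  assumes "u \<in> Units R"
  shows "h u \<in> Units S"
proof -
  from assms obtain v where uv: "u \<in> carrier R" "v \<in> carrier R" "v \<otimes> u = \<one>" "u \<otimes> v = \<one>"
    unfolding Units_def by auto
  then have "h v \<otimes>\<^bsub>S\<^esub> h u = \<one>\<^bsub>S\<^esub>" "h u \<otimes>\<^bsub>S\<^esub> h v = \<one>\<^bsub>S\<^esub>"
    by (simp_all flip: hom_mult)
  then show ?thesis
    unfolding Units_def using uv by auto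
qed

lemma hom_brackets:
  assumes "a \<in> carrier R" "b \<in> carrier R"
  shows hom_angle_br: "h (angle_br R n a b) = angle_br S n (h a) (h b)"
    and hom_bracket_L: "h (bracket_L R n a b) = bracket_L S n (h a) (h b)"
    and hom_bracket_R: "h (bracket_R R n a b) = bracket_R S n (h a) (h b)"
  using assms by (simp_all add: angle_br_def bracket_L_def bracket_R_def hom_minus hom_nat_pow)

lemma property_K_hom:
  assumes "property_K R n"
  shows "property_K S n"
proof -
  obtain a b where ab: "potent R n a" "potent R n b"
    and units: "bracket_L R n a b \<in> Units R" "bracket_R R n a b \<in> Units R"
    using assms unfolding property_K_def by blast
  have "a \<in> carrier R" "b \<in> carrier R"
    using ab by (simp_all add: potent_def)
  then have "bracket_L S n (h a) (h b) \<in> Units S" "bracket_R S n (h a) (h b) \<in> Units S"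
    using units[THEN hom_Units] by (simp_all add: hom_bracket_L hom_bracket_R)
  then show ?thesis
    unfolding property_K_def using ab[THEN hom_potent] by blast
qed

lemma property_K_bar_hom:
  assumes "property_K_bar R n"
  shows "property_K_bar S n"
proof -
  obtain a b where ab: "potent R n a" "potent R n b" and unit: "angle_br R n a b \<in> Units R"
    using assms unfolding property_K_bar_def by blast
  have "a \<in> carrier R" "b \<in> carrier R"
    using ab by (simp_all add: potent_def)
  then have "angle_br S n (h a) (h b) \<in> Units S"
    using hom_Units[OF unit] by (simp add: hom_angle_br)
  then show ?thesis
    unfolding property_K_bar_def using ab[THEN hom_potent] by blast
qed

end

section \<open>Finite sums in abelian monoids\<close>

context abelian_monoid
begin

lemma finsum_single:
  assumes "finite A" "i \<in> A" "f i \<in> carrier G" "\<And>k. k \<in> A \<Longrightarrow> k \<noteq> i \<Longrightarrow> f k = \<zero>"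
  shows "finsum G f A = f i"
proof -
  have "finsum G f A = (\<Oplus>k\<in>A. if i = k then f k else \<zero>)"
    using assms by (intro finsum_cong') auto
  also have "\<dots> = f i"
    using assms by (intro finsum_singleton) (auto, metis zero_closed)
  finally show ?thesis .
qed

lemma finsum_swap:
  assumes "finite A" "finite B" "\<And>i j. i \<in> A \<Longrightarrow> j \<in> B \<Longrightarrow> f i j \<in> carrier G"
  shows "(\<Oplus>i\<in>A. \<Oplus>j\<in>B. f i j) = (\<Oplus>j\<in>B. \<Oplus>i\<in>A. f i j)"
  using assms(1,3)
proof (induction A rule: finite_induct)
  case empty
  then show ?case by simp
next
  case (insert x A)
  have "(\<Oplus>i\<in>insert x A. \<Oplus>j\<in>B. f i j) = (\<Oplus>j\<in>B. f x j) \<oplus> (\<Oplus>j\<in>B. \<Oplus>i\<in>A. f i j)"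
    using insert by (subst finsum_insert) (auto intro!: finsum_closed)
  also have "\<dots> = (\<Oplus>j\<in>B. f x j \<oplus> (\<Oplus>i\<in>A. f i j))"
    using insert.prems by (intro finsum_addf[symmetric]) (auto intro!: finsum_closed)
  also have "\<dots> = (\<Oplus>j\<in>B. \<Oplus>i\<in>insert x A. f i j)"
    using insert
    by (intro finsum_cong') (auto intro!: finsum_closed simp: Pi_def)
  finally show ?case .
qed

end

section \<open>The matrix ring\<close>

lemma mat_ring_simps:
  "A \<in> carrier (mat_ring R m) \<longleftrightarrow> A \<in> carrier_mat m m \<and> (\<forall>i<m. \<forall>j<m. A $$ (i, j) \<in> carrier R)"
  "A \<otimes>\<^bsub>mat_ring R m\<^esub> B = mat m m (\<lambda>(i, j). \<Oplus>\<^bsub>R\<^esub>k\<in>{..<m}. A $$ (i, k) \<otimes>\<^bsub>R\<^esub> B $$ (k, j))"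
  "\<one>\<^bsub>mat_ring R m\<^esub> = mat m m (\<lambda>(i, j). if i = j then \<one>\<^bsub>R\<^esub> else \<zero>\<^bsub>R\<^esub>)"
  "\<zero>\<^bsub>mat_ring R m\<^esub> = mat m m (\<lambda>(i, j). \<zero>\<^bsub>R\<^esub>)"
  "A \<oplus>\<^bsub>mat_ring R m\<^esub> B = mat m m (\<lambda>(i, j). A $$ (i, j) \<oplus>\<^bsub>R\<^esub> B $$ (i, j))"
  unfolding mat_ring_def by auto

context ring
begin

lemma mat_ring_mult_assoc:
  assumes A: "A \<in> carrier (mat_ring R m)" and B: "B \<in> carrier (mat_ring R m)"
    and C: "C \<in> carrier (mat_ring R m)"
  shows "(A \<otimes>\<^bsub>mat_ring R m\<^esub> B) \<otimes>\<^bsub>mat_ring R m\<^esub> C = A \<otimes>\<^bsub>mat_ring R m\<^esub> (B \<otimes>\<^bsub>mat_ring R m\<^esub> C)"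
    (is "?L = ?R")
proof (rule eq_matI)
  fix i j assume "i < dim_row ?R" "j < dim_col ?R"
  then have ij: "i < m" "j < m"
    by (auto simp: mat_ring_simps)
  have clA: "A $$ (p, q) \<in> carrier R" and clB: "B $$ (p, q) \<in> carrier R"
    and clC: "C $$ (p, q) \<in> carrier R" if "p < m" "q < m" for p q
    using A B C that by (auto simp: mat_ring_simps)
  have "?L $$ (i, j) = (\<Oplus>k\<in>{..<m}. (\<Oplus>l\<in>{..<m}. A $$ (i, l) \<otimes> B $$ (l, k)) \<otimes> C $$ (k, j))"
    using ij
    by (simp add: mat_ring_simps)
       (intro finsum_cong'; auto intro!: finsum_closed m_closed clA clB clC)
  also have "\<dots> = (\<Oplus>k\<in>{..<m}. \<Oplus>l\<in>{..<m}. A $$ (i, l) \<otimes> (B $$ (l, k) \<otimes> C $$ (k, j)))"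
  proof (intro finsum_cong')
    fix k assume k: "k \<in> {..<m}"
    have "(\<Oplus>l\<in>{..<m}. A $$ (i, l) \<otimes> B $$ (l, k)) \<otimes> C $$ (k, j)
        = (\<Oplus>l\<in>{..<m}. A $$ (i, l) \<otimes> B $$ (l, k) \<otimes> C $$ (k, j))"
      using ij k by (intro finsum_ldistr) (auto intro!: m_closed clA clB clC)
    also have "\<dots> = (\<Oplus>l\<in>{..<m}. A $$ (i, l) \<otimes> (B $$ (l, k) \<otimes> C $$ (k, j)))"
      using ij k by (intro finsum_cong') (auto intro!: m_closed m_assoc clA clB clC)
    finally show "(\<Oplus>l\<in>{..<m}. A $$ (i, l) \<otimes> B $$ (l, k)) \<otimes> C $$ (k, j)
        = (\<Oplus>l\<in>{..<m}. A $$ (i, l) \<otimes> (B $$ (l, k) \<otimes> C $$ (k, j)))" .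
  qed (use ij in \<open>auto intro!: finsum_closed m_closed clA clB clC\<close>)
  also have "\<dots> = (\<Oplus>l\<in>{..<m}. \<Oplus>k\<in>{..<m}. A $$ (i, l) \<otimes> (B $$ (l, k) \<otimes> C $$ (k, j)))"
    using ij by (intro finsum_swap) (auto intro!: m_closed clA clB clC)
  also have "\<dots> = (\<Oplus>l\<in>{..<m}. A $$ (i, l) \<otimes> (\<Oplus>k\<in>{..<m}. B $$ (l, k) \<otimes> C $$ (k, j)))"
    using ij
    by (intro finsum_cong' finsum_rdistr[symmetric])
       (auto intro!: finsum_closed m_closed clA clB clC)
  also have "\<dots> = ?R $$ (i, j)"
    using ij
    by (simp add: mat_ring_simps)
       (intro finsum_cong'; auto intro!: finsum_closed m_closed clA clB clC)
  finally show "?L $$ (i, j) = ?R $$ (i, j)" .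
qed (auto simp: mat_ring_simps)

lemma mat_ring_one_mult:
  assumes A: "A \<in> carrier (mat_ring R m)"
  shows "\<one>\<^bsub>mat_ring R m\<^esub> \<otimes>\<^bsub>mat_ring R m\<^esub> A = A" and "A \<otimes>\<^bsub>mat_ring R m\<^esub> \<one>\<^bsub>mat_ring R m\<^esub> = A"
proof -
  have cl: "A $$ (p, q) \<in> carrier R" if "p < m" "q < m" for p q
    using A that by (auto simp: mat_ring_simps)
  have dims: "dim_row A = m" "dim_col A = m"
    using A by (auto simp: mat_ring_simps)
  show "\<one>\<^bsub>mat_ring R m\<^esub> \<otimes>\<^bsub>mat_ring R m\<^esub> A = A"
  proof (rule eq_matI)
    fix i j assume "i < dim_row A" "j < dim_col A"
    then have ij: "i < m" "j < m" using dims by auto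
    then show "(\<one>\<^bsub>mat_ring R m\<^esub> \<otimes>\<^bsub>mat_ring R m\<^esub> A) $$ (i, j) = A $$ (i, j)"
      using cl by (simp add: mat_ring_simps) (subst finsum_single[of _ i]; auto)
  qed (auto simp: mat_ring_simps dims)
  show "A \<otimes>\<^bsub>mat_ring R m\<^esub> \<one>\<^bsub>mat_ring R m\<^esub> = A"
  proof (rule eq_matI)
    fix i j assume "i < dim_row A" "j < dim_col A"
    then have ij: "i < m" "j < m" using dims by auto
    then show "(A \<otimes>\<^bsub>mat_ring R m\<^esub> \<one>\<^bsub>mat_ring R m\<^esub>) $$ (i, j) = A $$ (i, j)"
      using cl by (simp add: mat_ring_simps) (subst finsum_single[of _ j]; auto)
  qed (auto simp: mat_ring_simps dims)
qed

lemma mat_ring_abelian_group: "abelian_group (mat_ring R m)"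
proof (rule abelian_groupI)
  fix A assume A: "A \<in> carrier (mat_ring R m)"
  let ?N = "mat m m (\<lambda>(i, j). \<ominus> A $$ (i, j))"
  have "?N \<in> carrier (mat_ring R m)" "?N \<oplus>\<^bsub>mat_ring R m\<^esub> A = \<zero>\<^bsub>mat_ring R m\<^esub>"
    using A by (auto simp: mat_ring_simps l_neg)
  then show "\<exists>B\<in>carrier (mat_ring R m). B \<oplus>\<^bsub>mat_ring R m\<^esub> A = \<zero>\<^bsub>mat_ring R m\<^esub>"
    by blast
qed (auto simp: mat_ring_simps a_assoc intro!: eq_matI a_comm)

lemma mat_ring_is_ring: "ring (mat_ring R m)"
proof (rule ringI)
  show "monoid (mat_ring R m)"
  proof (rule monoidI)
    fix A B assume "A \<in> carrier (mat_ring R m)" "B \<in> carrier (mat_ring R m)"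
    then show "A \<otimes>\<^bsub>mat_ring R m\<^esub> B \<in> carrier (mat_ring R m)"
      by (auto simp: mat_ring_simps intro!: finsum_closed)
  next
    show "\<one>\<^bsub>mat_ring R m\<^esub> \<in> carrier (mat_ring R m)"
      by (auto simp: mat_ring_simps)
  qed (simp_all add: mat_ring_mult_assoc mat_ring_one_mult)
next
  fix A B C
  assume "A \<in> carrier (mat_ring R m)" "B \<in> carrier (mat_ring R m)" "C \<in> carrier (mat_ring R m)"
  then have cl: "A $$ (p, q) \<in> carrier R" "B $$ (p, q) \<in> carrier R" "C $$ (p, q) \<in> carrier R"
    if "p < m" "q < m" for p q
    using that by (auto simp: mat_ring_simps)
  show "(A \<oplus>\<^bsub>mat_ring R m\<^esub> B) \<otimes>\<^bsub>mat_ring R m\<^esub> C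
      = A \<otimes>\<^bsub>mat_ring R m\<^esub> C \<oplus>\<^bsub>mat_ring R m\<^esub> B \<otimes>\<^bsub>mat_ring R m\<^esub> C"
  proof (rule eq_matI, goal_cases)
    case (1 i j)
    then have ij: "i < m" "j < m" by (auto simp: mat_ring_simps)
    have "(\<Oplus>k\<in>{..<m}. (A $$ (i, k) \<oplus> B $$ (i, k)) \<otimes> C $$ (k, j))
        = (\<Oplus>k\<in>{..<m}. A $$ (i, k) \<otimes> C $$ (k, j) \<oplus> B $$ (i, k) \<otimes> C $$ (k, j))"
      using ij cl by (intro finsum_cong') (auto simp: l_distr)
    also have "\<dots> = (\<Oplus>k\<in>{..<m}. A $$ (i, k) \<otimes> C $$ (k, j)) \<oplus> (\<Oplus>k\<in>{..<m}. B $$ (i, k) \<otimes> C $$ (k, j))"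
      using ij cl by (intro finsum_addf) auto
    finally show ?case
      using ij cl by (simp add: mat_ring_simps cong: finsum_cong)
  qed (auto simp: mat_ring_simps)
  show "C \<otimes>\<^bsub>mat_ring R m\<^esub> (A \<oplus>\<^bsub>mat_ring R m\<^esub> B)
      = C \<otimes>\<^bsub>mat_ring R m\<^esub> A \<oplus>\<^bsub>mat_ring R m\<^esub> C \<otimes>\<^bsub>mat_ring R m\<^esub> B"
  proof (rule eq_matI, goal_cases)
    case (1 i j)
    then have ij: "i < m" "j < m" by (auto simp: mat_ring_simps)
    have "(\<Oplus>k\<in>{..<m}. C $$ (i, k) \<otimes> (A $$ (k, j) \<oplus> B $$ (k, j)))
        = (\<Oplus>k\<in>{..<m}. C $$ (i, k) \<otimes> A $$ (k, j) \<oplus> C $$ (i, k) \<otimes> B $$ (k, j))"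
      using ij cl by (intro finsum_cong') (auto simp: r_distr)
    also have "\<dots> = (\<Oplus>k\<in>{..<m}. C $$ (i, k) \<otimes> A $$ (k, j)) \<oplus> (\<Oplus>k\<in>{..<m}. C $$ (i, k) \<otimes> B $$ (k, j))"
      using ij cl by (intro finsum_addf) auto
    finally show ?case
      using ij cl by (simp add: mat_ring_simps cong: finsum_cong)
  qed (auto simp: mat_ring_simps)
qed (rule mat_ring_abelian_group)

lemma mat_ring_a_inv:
  assumes "A \<in> carrier (mat_ring R m)"
  shows "\<ominus>\<^bsub>mat_ring R m\<^esub> A = mat m m (\<lambda>(i, j). \<ominus> A $$ (i, j))"
proof (rule abelian_group.minus_equality[OF mat_ring_abelian_group])
  show "mat m m (\<lambda>(i, j). \<ominus> A $$ (i, j)) \<oplus>\<^bsub>mat_ring R m\<^esub> A = \<zero>\<^bsub>mat_ring R m\<^esub>"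
    using assms by (auto simp: mat_ring_simps l_neg)
qed (use assms in \<open>auto simp: mat_ring_simps\<close>)

section \<open>The ring of upper triangular matrices with constant diagonal\<close>

lemma D_ring_simps:
  "A \<in> carrier (D_ring m R) \<longleftrightarrow> A \<in> carrier (mat_ring R m) \<and>
     (\<forall>i<m. \<forall>j<i. A $$ (i, j) = \<zero>) \<and> (\<forall>i<m. \<forall>j<m. A $$ (i, i) = A $$ (j, j))"
  "A \<otimes>\<^bsub>D_ring m R\<^esub> B = A \<otimes>\<^bsub>mat_ring R m\<^esub> B"
  "\<one>\<^bsub>D_ring m R\<^esub> = \<one>\<^bsub>mat_ring R m\<^esub>"
  "A \<oplus>\<^bsub>D_ring m R\<^esub> B = A \<oplus>\<^bsub>mat_ring R m\<^esub> B"
  unfolding D_ring_def by auto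

text \<open>
  Membership is used through separate rules: as a rewrite rule, the equality of any two diagonal
  entries has a free index on its right-hand side and makes the simplifier loop.
\<close>
lemma D_ringD:
  assumes "A \<in> carrier (D_ring m R)"
  shows D_ring_in_mat_ring: "A \<in> carrier (mat_ring R m)"
    and D_ring_entry_closed: "i < m \<Longrightarrow> j < m \<Longrightarrow> A $$ (i, j) \<in> carrier R"
    and D_ring_lower: "i < m \<Longrightarrow> j < i \<Longrightarrow> A $$ (i, j) = \<zero>"
    and D_ring_diag: "i < m \<Longrightarrow> j < m \<Longrightarrow> A $$ (i, i) = A $$ (j, j)"
  using assms unfolding D_ring_simps mat_ring_simps by blast+

lemma D_ringI:
  assumes "A \<in> carrier (mat_ring R m)" "\<And>i j. i < m \<Longrightarrow> j < i \<Longrightarrow> A $$ (i, j) = \<zero>"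
    and "\<And>i j. i < m \<Longrightarrow> j < m \<Longrightarrow> A $$ (i, i) = A $$ (j, j)"
  shows "A \<in> carrier (D_ring m R)"
  using assms unfolding D_ring_simps by blast

text \<open>
  This is what makes reading off the diagonal entry multiplicative, and it also shows that the
  diagonal of a product is again constant.
\<close>
lemma D_ring_mult_diag:
  assumes A: "A \<in> carrier (D_ring m R)" and B: "B \<in> carrier (D_ring m R)" and i: "i < m"
  shows "(A \<otimes>\<^bsub>mat_ring R m\<^esub> B) $$ (i, i) = A $$ (i, i) \<otimes> B $$ (i, i)"
proof -
  \<comment> \<open>For \<open>k < i\<close> the left factor lies below the diagonal, for \<open>k > i\<close> the right one does.\<close>
  have "A $$ (i, k) \<otimes> B $$ (k, i) = \<zero>" if "k < m" "k \<noteq> i" for k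
    using that i by (cases "k < i")
      (simp_all add: D_ring_lower[OF A] D_ring_lower[OF B] D_ring_entry_closed[OF A] D_ring_entry_closed[OF B])
  then have "(\<Oplus>k\<in>{..<m}. A $$ (i, k) \<otimes> B $$ (k, i)) = A $$ (i, i) \<otimes> B $$ (i, i)"
    using i by (intro finsum_single) (auto simp: D_ring_entry_closed[OF A] D_ring_entry_closed[OF B])
  then show ?thesis
    using i by (simp add: mat_ring_simps)
qed

lemma D_ring_mult_lower:
  assumes A: "A \<in> carrier (D_ring m R)" and B: "B \<in> carrier (D_ring m R)" and ij: "i < m" "j < i"
  shows "(A \<otimes>\<^bsub>mat_ring R m\<^esub> B) $$ (i, j) = \<zero>"
proof -
  \<comment> \<open>If \<open>k \<ge> i\<close>, then \<open>k > j\<close>, so one of the two factors always lies below the diagonal.\<close>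
  have "A $$ (i, k) \<otimes> B $$ (k, j) = \<zero>" if "k < m" for k
    using that ij by (cases "k < i")
      (simp_all add: D_ring_lower[OF A] D_ring_lower[OF B] D_ring_entry_closed[OF A] D_ring_entry_closed[OF B])
  then have "(\<Oplus>k\<in>{..<m}. A $$ (i, k) \<otimes> B $$ (k, j)) = (\<Oplus>k\<in>{..<m}. \<zero>)"
    by (intro finsum_cong') auto
  then show ?thesis
    using ij by (simp add: mat_ring_simps)
qed

lemma D_ring_is_ring: "ring (D_ring m R)"
proof -
  interpret M: ring "mat_ring R m" by (rule mat_ring_is_ring)
  have "subring (carrier (D_ring m R)) (mat_ring R m)"
  proof (rule M.subringI)
    fix A B assume A: "A \<in> carrier (D_ring m R)" and B: "B \<in> carrier (D_ring m R)"
    have diag: "A $$ (i, i) = A $$ (j, j)" "B $$ (i, i) = B $$ (j, j)" if "i < m" "j < m" for i j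
      using D_ring_diag[OF A that] D_ring_diag[OF B that] by auto
    show "A \<otimes>\<^bsub>mat_ring R m\<^esub> B \<in> carrier (D_ring m R)"
    proof (rule D_ringI)
      show "A \<otimes>\<^bsub>mat_ring R m\<^esub> B \<in> carrier (mat_ring R m)"
        using A B by (simp add: D_ring_in_mat_ring)
      show "(A \<otimes>\<^bsub>mat_ring R m\<^esub> B) $$ (i, i) = (A \<otimes>\<^bsub>mat_ring R m\<^esub> B) $$ (j, j)"
        if "i < m" "j < m" for i j
        using diag[OF that] that by (simp only: D_ring_mult_diag[OF A B])
    qed (rule D_ring_mult_lower[OF A B])
    show "A \<oplus>\<^bsub>mat_ring R m\<^esub> B \<in> carrier (D_ring m R)"
    proof (rule D_ringI)
      show "A \<oplus>\<^bsub>mat_ring R m\<^esub> B \<in> carrier (mat_ring R m)"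
        using A B by (simp add: D_ring_in_mat_ring)
      show "(A \<oplus>\<^bsub>mat_ring R m\<^esub> B) $$ (i, j) = \<zero>" if "i < m" "j < i" for i j
        using that by (simp add: mat_ring_simps D_ring_lower[OF A] D_ring_lower[OF B])
      show "(A \<oplus>\<^bsub>mat_ring R m\<^esub> B) $$ (i, i) = (A \<oplus>\<^bsub>mat_ring R m\<^esub> B) $$ (j, j)"
        if "i < m" "j < m" for i j
        using diag[OF that] that by (simp add: mat_ring_simps)
    qed
  next
    fix A assume A: "A \<in> carrier (D_ring m R)"
    note inv = mat_ring_a_inv[OF D_ring_in_mat_ring[OF A]]
    show "\<ominus>\<^bsub>mat_ring R m\<^esub> A \<in> carrier (D_ring m R)"
    proof (rule D_ringI)
      show "\<ominus>\<^bsub>mat_ring R m\<^esub> A \<in> carrier (mat_ring R m)"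
        using A by (simp add: D_ring_in_mat_ring)
      show "(\<ominus>\<^bsub>mat_ring R m\<^esub> A) $$ (i, j) = \<zero>" if "i < m" "j < i" for i j
        using that by (simp add: inv D_ring_lower[OF A])
      show "(\<ominus>\<^bsub>mat_ring R m\<^esub> A) $$ (i, i) = (\<ominus>\<^bsub>mat_ring R m\<^esub> A) $$ (j, j)"
        if "i < m" "j < m" for i j
        using D_ring_diag[OF A that] that by (simp add: inv)
    qed
  next
    show "\<one>\<^bsub>mat_ring R m\<^esub> \<in> carrier (D_ring m R)"
      by (rule D_ringI) (simp_all add: mat_ring_simps)
  qed (auto dest: D_ring_in_mat_ring)
  then have "ring ((mat_ring R m)\<lparr>carrier := carrier (D_ring m R)\<rparr>)"
    by (rule M.subring_is_ring)
  moreover have "(mat_ring R m)\<lparr>carrier := carrier (D_ring m R)\<rparr> = D_ring m R"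
    by (simp add: D_ring_def)
  ultimately show ?thesis by simp
qed

lemma diagonal_entry_hom:
  assumes "m \<ge> 1"
  shows "ring_hom_ring (D_ring m R) R (\<lambda>A. A $$ (0, 0))"
proof (rule ring_hom_ringI[OF D_ring_is_ring ring_axioms])
  fix A B assume "A \<in> carrier (D_ring m R)" "B \<in> carrier (D_ring m R)"
  then show "(A \<otimes>\<^bsub>D_ring m R\<^esub> B) $$ (0, 0) = A $$ (0, 0) \<otimes> B $$ (0, 0)"
    using assms by (simp add: D_ring_simps(2) D_ring_mult_diag)
qed (use assms in \<open>auto simp: D_ring_simps(2-) mat_ring_simps(2-) intro: D_ring_entry_closed\<close>)

text \<open>
  Multiplying by a scalar matrix leaves one summand in each entry of the product, namely the one
  that meets the diagonal of the left factor.
\<close>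
lemma scalar_matrix_hom:
  "ring_hom_ring R (D_ring m R) (\<lambda>x. mat m m (\<lambda>(i, j). if i = j then x else \<zero>))"
    (is "ring_hom_ring R _ ?s")
proof (rule ring_hom_ringI[OF ring_axioms D_ring_is_ring])
  fix x y assume xy: "x \<in> carrier R" "y \<in> carrier R"
  show "?s (x \<otimes> y) = ?s x \<otimes>\<^bsub>D_ring m R\<^esub> ?s y"
  proof (rule eq_matI, goal_cases)
    case (1 i j)
    then have ij: "i < m" "j < m" by (auto simp: D_ring_simps mat_ring_simps)
    have "(\<Oplus>k\<in>{..<m}. ?s x $$ (i, k) \<otimes> ?s y $$ (k, j)) = ?s x $$ (i, i) \<otimes> ?s y $$ (i, j)"
      using ij xy by (intro finsum_single) auto
    then show ?case
      using ij xy by (simp add: D_ring_simps mat_ring_simps)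
  qed (auto simp: D_ring_simps mat_ring_simps)
  show "?s (x \<oplus> y) = ?s x \<oplus>\<^bsub>D_ring m R\<^esub> ?s y"
    using xy by (auto simp: D_ring_simps mat_ring_simps)
  show "?s x \<in> carrier (D_ring m R)"
    using xy by (intro D_ringI) (auto simp: mat_ring_simps)
qed (auto simp: D_ring_simps mat_ring_simps)

end

theorem theorem3p4:
  fixes S :: "('a, 'b) ring_scheme"
  assumes "ring S"
  shows "(\<forall>m n :: nat. m \<ge> 1 \<longrightarrow> n \<ge> 2 \<longrightarrow>
            (property_K (D_ring m S) n \<longleftrightarrow> property_K S n))
       \<and> (\<forall>m n :: nat. m \<ge> 1 \<longrightarrow> n \<ge> 2 \<longrightarrow>
            (property_K_bar (D_ring m S) n \<longleftrightarrow> property_K_bar S n))"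
  using ring_hom_ring.property_K_hom[OF ring.diagonal_entry_hom[OF assms]]
    ring_hom_ring.property_K_hom[OF ring.scalar_matrix_hom[OF assms]]
    ring_hom_ring.property_K_bar_hom[OF ring.diagonal_entry_hom[OF assms]]
    ring_hom_ring.property_K_bar_hom[OF ring.scalar_matrix_hom[OF assms]]
  by blast

end
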